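(* Let $p,q$ be real numbers with $0<q<p$. For all $m,n\in\mathbb{N}=\{1,2,3,\dots\}$, $$B_{p,q}(m,n)=p^{(n-1)(2m+n-2)/2}\,\frac{\Gamma_{p,q}(m)\,\Gamma_{p,q}(n)}{\Gamma_{p,q}(m+n)},$$ where $B_{p,q}$ is the $(p,q)$-Beta integral and $\Gamma_{p,q}$ is the $(p,q)$-Gamma function.
   Context: Let $0<q<p$. The $(p,q)$-numbers are $[n]_{p,q}=\frac{p^n-q^n}{p-q}$, and $[n]_{p,q}!=\prod_{k=1}^n[k]_{p,q}$ for $n\ge1$, $[0]_{p,q}!=1$. The $(p,q)$-power basis is $(x\ominus a)_{p,q}^n=(x-a)(px-qa)(p^2x-q^2a)\cdots(p^{n-1}x-q^{n-1}a)$, with $(x\ominus a)_{p,q}^0=1$. In particular $(1\ominus qx)_{p,q}^{n}=\prod_{i=0}^{n-1}(p^i-q^{i+1}x)$. The $(p,q)$-integral of a function $f$ on $[0,a]$ is (for $0<q<p$) $$\int_0^a f(x)\,d_{p,q}x=(p-q)\,a\sum_{k=0}^\infty \frac{q^k}{p^{k+1}}\,f\!\left(\frac{q^k}{p^{k+1}}a\right).$$ The $(p,q)$-Gamma function at positive integers is, for an integer $n\ge0$, $\Gamma_{p,q}(n+1)=\frac{(p\ominus q)_{p,q}^n}{(p-q)^n}=[n]_{p,q}!$. The $(p,q)$-Beta integral is, for $m,n\in\mathbb{N}$, $$B_{p,q}(m,n)=\int_0^1 x^{m-1}(1\ominus qx)_{p,q}^{n-1}\,d_{p,q}x.$$ 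*)

theory Defs
  imports Complex_Main
begin

definition pq_number :: "real \<Rightarrow> real \<Rightarrow> nat \<Rightarrow> real" where
  "pq_number p q n = (p ^ n - q ^ n) / (p - q)"

definition pq_fact :: "real \<Rightarrow> real \<Rightarrow> nat \<Rightarrow> real" where
  "pq_fact p q n = (\<Prod>k=1..n. pq_number p q k)"

text \<open>The \<open>(p,q)\<close>-power basis \<open>(x \<ominus> a)\<^sup>n\<close>; the first two arguments are the
  parameters \<open>p\<close>, \<open>q\<close>.\<close>

definition pq_power :: "real \<Rightarrow> real \<Rightarrow> real \<Rightarrow> real \<Rightarrow> nat \<Rightarrow> real" where
  "pq_power p q x a n = (\<Prod>i<n. p ^ i * x - q ^ i * a)"

text \<open>The \<open>(p,q)\<close>-integral of \<open>f\<close> over \<open>[0,a]\<close> for \<open>0 < q < p\<close>. It is meaningful when the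
  series converges; \<^const>\<open>suminf\<close> has an unspecified value otherwise.\<close>

definition pq_integral :: "real \<Rightarrow> real \<Rightarrow> real \<Rightarrow> (real \<Rightarrow> real) \<Rightarrow> real" where
  "pq_integral p q a f =
     (p - q) * a * (\<Sum>k. q ^ k / p ^ (k + 1) * f (q ^ k / p ^ (k + 1) * a))"

text \<open>The \<open>(p,q)\<close>-Gamma function at positive integers, i.e. \<open>\<Gamma>(n + 1) = (p \<ominus> q)\<^sup>n / (p - q)\<^sup>n\<close>.
  Because of truncated subtraction the value at \<open>0\<close> is \<open>1\<close>, which has no meaning.\<close>

definition pq_Gamma :: "real \<Rightarrow> real \<Rightarrow> nat \<Rightarrow> real" where
  "pq_Gamma p q n = pq_power p q p q (n - 1) / (p - q) ^ (n - 1)"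

lemma pq_Gamma_Suc: "pq_Gamma p q (n + 1) = pq_fact p q n"
proof -
  have "pq_Gamma p q (n + 1) = (\<Prod>i<n. p ^ Suc i - q ^ Suc i) / (p - q) ^ n"
    by (simp add: pq_Gamma_def pq_power_def mult.commute)
  also have "\<dots> = (\<Prod>i<n. pq_number p q (Suc i))"
    by (simp add: pq_number_def prod_dividef)
  also have "\<dots> = pq_fact p q n"
    by (simp add: pq_fact_def prod.atLeast1_atMost_eq)
  finally show ?thesis .
qed

text \<open>The \<open>(p,q)\<close>-Beta integral, for \<open>m, n \<ge> 1\<close>.\<close>

definition pq_Beta :: "real \<Rightarrow> real \<Rightarrow> nat \<Rightarrow> nat \<Rightarrow> real" where
  "pq_Beta p q m n = pq_integral p q 1 (\<lambda>x. x ^ (m - 1) * pq_power p q 1 (q * x) (n - 1))"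

end

theory Submission
  imports Defs
begin

text \<open>Splitting off the last factor \<open>p\<^sup>n\<^sup>-\<^sup>1 - q\<^sup>nx\<close> of the power basis gives the recursion
  \<open>B(m, n + 1) = p\<^sup>n\<^sup>-\<^sup>1 B(m, n) - q\<^sup>n B(m + 1, n)\<close>, so no integration by parts is needed. The closed
  form satisfies the same recursion because \<open>[m + n] - q\<^sup>n [m] = p\<^sup>m [n]\<close>, and \<open>B(m, 1)\<close> is a
  geometric series.\<close>

lemma pq_number_pos:
  assumes "0 < q" "q < p" "0 < n"
  shows "0 < pq_number p q n"
  using assms by (simp add: pq_number_def power_strict_mono)

lemma pq_fact_Suc: "pq_fact p q (Suc n) = pq_number p q (Suc n) * pq_fact p q n"
  by (simp add: pq_fact_def mult.commute)

lemma pq_fact_pos: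
  assumes "0 < q" "q < p"
  shows "0 < pq_fact p q n"
  unfolding pq_fact_def using assms by (intro prod_pos) (auto intro: pq_number_pos)

text \<open>Insert the mixed term \<open>p ^ m * q ^ n\<close> between \<open>p ^ (m + n)\<close>
  and \<open>q ^ (m + n)\<close>.\<close>

lemma pq_number_add: "pq_number p q (m + n) = q ^ n * pq_number p q m + p ^ m * pq_number p q n"
  by (simp add: pq_number_def power_add flip: add_divide_distrib) (simp add: algebra_simps)

lemma pq_power_Suc: "pq_power p q x a (Suc n) = pq_power p q x a n * (p ^ n * x - q ^ n * a)"
  by (simp add: pq_power_def)

text \<open>The case of an empty power basis: with \<open>x = q ^ k / p ^ Suc k\<close> the summand
  is \<open>x ^ Suc m\<close>, which is geometric in \<open>k\<close> with ratio
  \<open>(q / p) ^ Suc m < 1\<close>.\<close>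

lemma pq_monomial_sums:
  fixes p q :: real
  assumes "0 < q" "q < p"
  shows "(\<lambda>k. q ^ k / p ^ Suc k * (q ^ k / p ^ Suc k) ^ m)
           sums (1 / ((p - q) * pq_number p q (Suc m)))"
proof -
  have "norm ((q / p) ^ Suc m) < 1"
    using assms by (simp add: power_less_one_iff abs_less_iff norm_power del: power_Suc)
  from sums_mult[OF geometric_sums[OF this], of "1 / p ^ Suc m"]
  have "(\<lambda>k. 1 / p ^ Suc m * ((q / p) ^ Suc m) ^ k) sums
          (1 / p ^ Suc m * (1 / (1 - (q / p) ^ Suc m)))" .
  moreover have "1 / p ^ Suc m * ((q / p) ^ Suc m) ^ k = q ^ k / p ^ Suc k * (q ^ k / p ^ Suc k) ^ m" for k
  proof -
    have "q ^ k / p ^ Suc k * (q ^ k / p ^ Suc k) ^ m = (q ^ k / p ^ Suc k) ^ Suc m"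
      by simp
    also have "\<dots> = (1 / p * (q / p) ^ k) ^ Suc m"
      by (simp add: power_divide)
    also have "\<dots> = 1 / p ^ Suc m * ((q / p) ^ Suc m) ^ k"
      by (simp only: power_mult_distrib power_one_over flip: power_mult) (simp add: mult.commute)
    finally show ?thesis ..
  qed
  moreover have "1 / p ^ Suc m * (1 / (1 - (q / p) ^ Suc m)) = 1 / ((p - q) * pq_number p q (Suc m))"
  proof -
    have "p ^ Suc m * (1 - (q / p) ^ Suc m) = (p - q) * pq_number p q (Suc m)"
      using assms by (simp add: pq_number_def power_divide right_diff_distrib[of "p ^ Suc m"] del: power_Suc)
    then show ?thesis
      by (simp only: times_divide_times_eq mult_1_left)
  qed
  ultimately show ?thesis
    by simp
qed

text \<open>Both indices are shifted down by one, which avoids truncated subtraction. Using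
  \<open>sums\<close> carries convergence through the induction, so that two series may be
  subtracted termwise. The quotient by \<open>p - q\<close> cancels the prefactor of the integral
  later.\<close>

lemma pq_Beta_series_sums:
  fixes p q :: real
  assumes "0 < q" "q < p"
  shows "(\<lambda>k. q ^ k / p ^ Suc k *
             ((q ^ k / p ^ Suc k) ^ m * pq_power p q 1 (q * (q ^ k / p ^ Suc k)) n))
           sums (p powr (real n * (2 * real m + real n + 1) / 2) *
             (pq_fact p q m * pq_fact p q n / pq_fact p q (Suc (m + n))) / (p - q))"
\<comment> \<open>The recursion lowers \<open>n\<close> but calls on both \<open>m\<close> and
  \<open>Suc m\<close>.\<close>
proof (induction n arbitrary: m)
  case 0
  have "pq_fact p q m > 0"
    using assms by (rule pq_fact_pos)
  then show ?case
    using pq_monomial_sums[OF assms, of m] assms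
    by (simp add: pq_power_def pq_fact_Suc) (simp add: pq_fact_def mult.commute)
next
  case (Suc n)
  let ?x = "\<lambda>k. q ^ k / p ^ Suc k"
  let ?e = "p powr (real n * (2 * real m + real n + 1) / 2)"
  let ?F = "pq_fact p q"
  let ?N = "pq_number p q"
  have pos: "?F (Suc (m + n)) > 0" "?N (Suc (m + Suc n)) > 0"
    using assms by (auto intro: pq_fact_pos pq_number_pos)
  \<comment> \<open>Both exponents exceed the one in \<open>?e\<close> by natural numbers, so
    \<open>?e\<close> can be factored out and only ordinary powers of \<open>p\<close>
    remain.\<close>
  have exponents:
    "real n * (2 * real (Suc m) + real n + 1) / 2 = real n * (2 * real m + real n + 1) / 2 + real n"
    "real (Suc n) * (2 * real m + real (Suc n) + 1) / 2 =
       real n * (2 * real m + real n + 1) / 2 + real n + real (Suc m)"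
    by (simp_all add: field_simps)
  have powr_nat: "p powr real k = p ^ k" for k
    using assms by (simp add: powr_realpow)
  have e1: "p powr (real n * (2 * real (Suc m) + real n + 1) / 2) = ?e * p ^ n"
    unfolding exponents powr_add powr_nat ..
  have e2: "p powr (real (Suc n) * (2 * real m + real (Suc n) + 1) / 2) = ?e * p ^ n * p ^ Suc m"
    unfolding exponents powr_add powr_nat ..
  \<comment> \<open>Over a common denominator the recursion for the closed form reduces to the
    bracket in the last factor, which \<open>pq_number_add\<close> evaluates.\<close>
  have "p ^ n * (?e * (?F m * ?F n / ?F (Suc (m + n))) / (p - q)) -
      q ^ Suc n * (?e * p ^ n * (?F (Suc m) * ?F n / ?F (Suc (Suc m + n))) / (p - q)) =
    ?e * p ^ n * ?F m * ?F n / (?F (Suc (m + n)) * ?N (Suc (m + Suc n)) * (p - q)) *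
      (?N (Suc (m + Suc n)) - q ^ Suc n * ?N (Suc m))"
    using pos assms by (simp add: pq_fact_Suc divide_simps del: power_Suc) (simp add: algebra_simps)
  also have "?N (Suc (m + Suc n)) - q ^ Suc n * ?N (Suc m) = p ^ Suc m * ?N (Suc n)"
    using pq_number_add[of p q "Suc m" "Suc n"] by simp
  also have "?e * p ^ n * ?F m * ?F n / (?F (Suc (m + n)) * ?N (Suc (m + Suc n)) * (p - q)) *
      (p ^ Suc m * ?N (Suc n)) =
    ?e * p ^ n * p ^ Suc m * (?F m * ?F (Suc n) / ?F (Suc (m + Suc n))) / (p - q)"
    by (simp add: pq_fact_Suc mult_ac)
  finally have value_eq: "p ^ n * (?e * (?F m * ?F n / ?F (Suc (m + n))) / (p - q)) -
      q ^ Suc n * (?e * p ^ n * (?F (Suc m) * ?F n / ?F (Suc (Suc m + n))) / (p - q)) =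
    ?e * p ^ n * p ^ Suc m * (?F m * ?F (Suc n) / ?F (Suc (m + Suc n))) / (p - q)" .
  \<comment> \<open>The recursion holds pointwise in \<open>x\<close>: the new factor of the power
    basis is \<open>p ^ n - q ^ Suc n * x\<close>.\<close>
  have term_eq: "p ^ n * (x * (x ^ m * pq_power p q 1 (q * x) n)) -
      q ^ Suc n * (x * (x ^ Suc m * pq_power p q 1 (q * x) n)) =
    x * (x ^ m * pq_power p q 1 (q * x) (Suc n))" for x
    by (simp add: pq_power_Suc algebra_simps)
  show ?case
    using sums_diff[OF sums_mult[OF Suc.IH[of m], of "p ^ n"]
        sums_mult[OF Suc.IH[of "Suc m"], of "q ^ Suc n"]]
    unfolding term_eq e1 e2 value_eq .
qed

theorem theorem2p3:
  fixes p q :: real and m n :: nat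
  assumes "0 < q" and "q < p" and "1 \<le> m" and "1 \<le> n"
  shows "pq_Beta p q m n =
    p powr ((real n - 1) * (2 * real m + real n - 2) / 2) *
      (pq_Gamma p q m * pq_Gamma p q n / pq_Gamma p q (m + n))"
proof -
  obtain M N where MN: "m = M + 1" "n = N + 1"
    using assms(3,4) by (metis add.commute le_Suc_ex)
  have exponent: "(real n - 1) * (2 * real m + real n - 2) / 2 = real N * (2 * real M + real N + 1) / 2"
    by (simp add: MN)
  \<comment> \<open>Here \<open>m + n = M + N + 2\<close>, so the factorial index is
    \<open>M + N + 1\<close>, not \<open>M + N\<close>.\<close>
  have Gamma_sum: "pq_Gamma p q (m + n) = pq_fact p q (Suc (M + N))"
    using pq_Gamma_Suc[of p q "Suc (M + N)"] by (simp add: MN)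
  have "pq_Beta p q m n = (p - q) * (p powr (real N * (2 * real M + real N + 1) / 2) *
      (pq_fact p q M * pq_fact p q N / pq_fact p q (Suc (M + N))) / (p - q))"
    using sums_unique[OF pq_Beta_series_sums[OF assms(1,2), of M N]]
    by (simp add: pq_Beta_def pq_integral_def MN)
  then show ?thesis
    using assms(2) unfolding exponent Gamma_sum unfolding MN pq_Gamma_Suc by simp
qed

end
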